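(* For $\alpha>0$ and $\lambda>0$ let $\mathbf H_{GR}(\alpha,\lambda)$ be the one-parameter generalized Rényi entropy of the Poisson distribution with parameter $\lambda$ (see context). There exists an interval $J\subset(0,1)$ (in a neighborhood of $0$) such that, for each $\alpha\in J$, $\mathbf H_{GR}(\alpha,\lambda)$ is decreasing as a function of $\lambda$ in a neighborhood of $\lambda=1$.
   Context: For $\lambda>0$ let $p_i(\lambda)=e^{-\lambda}\lambda^i/i!$, $i\ge0$ (Poisson distribution); $\log$ is the natural logarithm. The one-parameter generalized Rényi entropy is $$\mathbf H_{GR}(\alpha,\lambda)=-\frac{\sum_{i=0}^\infty p_i(\lambda)^\alpha\log p_i(\lambda)}{\sum_{i=0}^\infty p_i(\lambda)^\alpha},\qquad \alpha>0.$$ *)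

theory Defs
  imports "HOL-Probability.Probability"
begin

(* Intended for distributions with p i > 0 for all i and convergent series, as is the case
   for the Poisson distribution with every alpha > 0 (lemmas below); ln is the natural logarithm. *)
definition gen_renyi_entropy :: "real \<Rightarrow> nat pmf \<Rightarrow> real" where
  "gen_renyi_entropy \<alpha> p =
     - (\<Sum>i. pmf p i powr \<alpha> * ln (pmf p i)) / (\<Sum>i. pmf p i powr \<alpha>)"

(* \<mu> is the Poisson parameter; only meaningful for \<mu> > 0 (poisson_pmf is unspecified otherwise). *)
definition H_GR :: "real \<Rightarrow> real \<Rightarrow> real" where
  "H_GR \<alpha> \<mu> = gen_renyi_entropy \<alpha> (poisson_pmf \<mu>)"

lemma H_GR_explicit:
  assumes "\<mu> > 0"
  shows "H_GR \<alpha> \<mu> =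
    - (\<Sum>i. (exp (- \<mu>) * \<mu> ^ i / fact i) powr \<alpha> * ln (exp (- \<mu>) * \<mu> ^ i / fact i))
      / (\<Sum>i. (exp (- \<mu>) * \<mu> ^ i / fact i) powr \<alpha>)"
  using assms by (simp add: H_GR_def gen_renyi_entropy_def mult.commute)

lemma summable_poisson_powr:
  assumes "\<mu> > 0" "\<alpha> > 0"
  shows "summable (\<lambda>i. pmf (poisson_pmf \<mu>) i powr \<alpha>)"
proof -
  let ?p = "\<lambda>i. pmf (poisson_pmf \<mu>) i"
  have step: "?p (Suc i) = ?p i * (\<mu> / real (Suc i))" for i
    using assms by (simp add: field_simps)
  have "(\<lambda>i. \<mu> * inverse (real (Suc i))) \<longlonglongrightarrow> \<mu> * 0"
    by (intro tendsto_mult tendsto_const LIMSEQ_inverse_real_of_nat)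
  then have "(\<lambda>i. \<mu> / real (Suc i)) \<longlonglongrightarrow> 0"
    by (simp only: divide_inverse mult_zero_right)
  then have "(\<lambda>i. (\<mu> / real (Suc i)) powr \<alpha>) \<longlonglongrightarrow> 0"
    by (rule tendsto_zero_powrI[OF _ tendsto_const]) (use assms in auto)
  then have "eventually (\<lambda>i. (\<mu> / real (Suc i)) powr \<alpha> < 1/2) sequentially"
    by (rule order_tendstoD) simp
  then obtain N where N: "\<And>i. i \<ge> N \<Longrightarrow> (\<mu> / real (Suc i)) powr \<alpha> < 1/2"
    by (auto simp: eventually_sequentially)
  show ?thesis
  proof (rule summable_ratio_test[where c = "1/2" and N = N])
    fix i assume "i \<ge> N"
    have "?p (Suc i) powr \<alpha> = ?p i powr \<alpha> * (\<mu> / real (Suc i)) powr \<alpha>"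
      unfolding step by (rule powr_mult)
    also have "\<dots> \<le> ?p i powr \<alpha> * (1/2)"
      using N[OF \<open>i \<ge> N\<close>] by (intro mult_left_mono) auto
    finally show "norm (?p (Suc i) powr \<alpha>) \<le> 1/2 * norm (?p i powr \<alpha>)"
      by simp
  qed simp
qed

lemma summable_poisson_powr_ln:
  assumes "\<mu> > 0" "\<alpha> > 0"
  shows "summable (\<lambda>i. pmf (poisson_pmf \<mu>) i powr \<alpha> * ln (pmf (poisson_pmf \<mu>) i))"
proof (rule summable_comparison_test')
  let ?p = "\<lambda>i. pmf (poisson_pmf \<mu>) i"
  show "summable (\<lambda>i. (2 / \<alpha>) * ?p i powr (\<alpha>/2))"
    using assms by (intro summable_mult summable_poisson_powr) auto
  fix i :: nat assume "i \<ge> 0"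
  have pos: "?p i > 0" using assms by simp
  have le: "?p i \<le> 1" by (rule pmf_le_1)
  have "ln (?p i powr (- (\<alpha>/2))) \<le> ?p i powr (- (\<alpha>/2))"
    using pos by (intro ln_bound) simp
  moreover have "ln (?p i powr (- (\<alpha>/2))) = - (\<alpha>/2) * ln (?p i)"
    by (rule ln_powr)
  ultimately have "(\<alpha>/2) * (- ln (?p i)) \<le> ?p i powr (- (\<alpha>/2))"
    by simp
  then have "- ln (?p i) \<le> (2 / \<alpha>) * ?p i powr (- (\<alpha>/2))"
    using mult_left_mono[of "(\<alpha>/2) * (- ln (?p i))" "?p i powr (- (\<alpha>/2))" "2/\<alpha>"] assms(2)
    by (simp del: pmf_poisson)
  then have "?p i powr \<alpha> * (- ln (?p i)) \<le> ?p i powr \<alpha> * ((2 / \<alpha>) * ?p i powr (- (\<alpha>/2)))"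
    by (intro mult_left_mono) auto
  also have "\<dots> = (2 / \<alpha>) * (?p i powr \<alpha> * ?p i powr (- (\<alpha>/2)))"
    by (simp only: mult.left_commute)
  also have "?p i powr \<alpha> * ?p i powr (- (\<alpha>/2)) = ?p i powr (\<alpha>/2)"
    by (simp only: powr_add[symmetric]) simp
  finally have "?p i powr \<alpha> * (- ln (?p i)) \<le> (2 / \<alpha>) * ?p i powr (\<alpha>/2)" .
  moreover have "ln (?p i) \<le> 0" using pos le by (simp only: ln_le_zero_iff)
  ultimately show "norm (?p i powr \<alpha> * ln (?p i)) \<le> (2 / \<alpha>) * ?p i powr (\<alpha>/2)"
    by (simp only: real_norm_def abs_mult abs_of_nonpos abs_of_nonneg powr_ge_zero)
qed

end

theory Submission
  imports Defs "HOL-Real_Asymp.Real_Asymp"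
begin

text \<open>
  Write \<open>E\<close> for the expectation under the weights \<open>a\<^sub>n = (n!) powr (-\<alpha>)\<close>, let \<open>Z\<close> be their total
  mass and \<open>N\<close> the identity variable. Differentiating under the sum, the derivative of the entropy
  in the parameter at 1 is \<open>1 - E N + \<alpha> Cov (ln N!, N)\<close>, and \<open>E N\<close> cancels against the main part of
  the covariance. Indeed \<open>(n+1) ln (n+1) - ln n! - n\<close> is nondecreasing, so \<open>Cov (ln N!, N)\<close> is at
  most \<open>Cov ((N+1) ln (N+1), N) - Var N\<close>. Put \<open>q n = 1 - (n+1) powr (-\<alpha>)\<close>; it agrees with
  \<open>\<alpha> ln (n+1)\<close> to first order, and \<open>a\<^sub>n\<^sub>+\<^sub>1 = a\<^sub>n (1 - q n)\<close> gives the summation by parts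
  \<open>E (G (N+1) q N) = E (G (N+1) - G N)\<close> for \<open>G 0 = 0\<close>. It yields \<open>Cov ((N+1) q N, N) = E N\<close> exactly and
  bounds the remaining error terms, so the derivative is at most \<open>14 - \<alpha> Var N\<close>. As the weights are
  at most 1, \<open>Var N\<close> is at least of order \<open>Z\<^sup>2\<close>, and \<open>Z\<close> is at least of order \<open>\<alpha> powr (-2/3)\<close>; hence
  \<open>\<alpha> Var N\<close> is unbounded as \<open>\<alpha>\<close> tends to 0.
\<close>

section \<open>Sequences of polynomial growth\<close>

text \<open>A class of summands closed under the operations below and always summable against the
  weights, so that sums can be split freely. The base \<open>real n + 1\<close> is positive also at
  \<open>n = 0\<close>.\<close>

definition poly_bounded :: "(nat \<Rightarrow> real) \<Rightarrow> bool" where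
  "poly_bounded g \<longleftrightarrow> (\<exists>C k. \<forall>n. \<bar>g n\<bar> \<le> C * (real n + 1) ^ k)"

lemma poly_bounded_mono:
  assumes "poly_bounded h" "\<And>n. \<bar>g n\<bar> \<le> \<bar>h n\<bar>"
  shows "poly_bounded g"
  using assms unfolding poly_bounded_def by (meson order_trans)

lemma poly_bounded_const: "poly_bounded (\<lambda>n. c)"
  unfolding poly_bounded_def by (intro exI[of _ "\<bar>c\<bar>"] exI[of _ 0]) auto

lemma poly_bounded_real: "poly_bounded (\<lambda>n. real n)"
  unfolding poly_bounded_def by (intro exI[of _ 1]) auto

lemma poly_bounded_add:
  assumes "poly_bounded f" "poly_bounded g"
  shows "poly_bounded (\<lambda>n. f n + g n)"
proof -
  from assms obtain C k D l where f: "\<And>n. \<bar>f n\<bar> \<le> C * (real n + 1) ^ k"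
    and g: "\<And>n. \<bar>g n\<bar> \<le> D * (real n + 1) ^ l"
    unfolding poly_bounded_def by blast
  have "\<bar>f n + g n\<bar> \<le> (\<bar>C\<bar> + \<bar>D\<bar>) * (real n + 1) ^ (k + l)" for n
  proof -
    have "C * (real n + 1) ^ k \<le> \<bar>C\<bar> * (real n + 1) ^ (k + l)"
      by (intro mult_mono power_increasing) auto
    moreover have "D * (real n + 1) ^ l \<le> \<bar>D\<bar> * (real n + 1) ^ (k + l)"
      by (intro mult_mono power_increasing) auto
    ultimately show ?thesis
      using f[of n] g[of n] abs_triangle_ineq[of "f n" "g n"] by (simp add: distrib_right)
  qed
  then show ?thesis unfolding poly_bounded_def by blast
qed

lemma poly_bounded_mult:
  assumes "poly_bounded f" "poly_bounded g"
  shows "poly_bounded (\<lambda>n. f n * g n)"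
proof -
  from assms obtain C k D l where f: "\<And>n. \<bar>f n\<bar> \<le> C * (real n + 1) ^ k"
    and g: "\<And>n. \<bar>g n\<bar> \<le> D * (real n + 1) ^ l"
    unfolding poly_bounded_def by blast
  have "\<bar>f n * g n\<bar> \<le> (C * D) * (real n + 1) ^ (k + l)" for n
  proof -
    have "\<bar>f n\<bar> * \<bar>g n\<bar> \<le> (C * (real n + 1) ^ k) * (D * (real n + 1) ^ l)"
      using f[of n] g[of n] by (intro mult_mono) auto
    then show ?thesis by (simp add: abs_mult power_add mult_ac)
  qed
  then show ?thesis unfolding poly_bounded_def by blast
qed

lemma poly_bounded_diff:
  assumes "poly_bounded f" "poly_bounded g"
  shows "poly_bounded (\<lambda>n. f n - g n)"
  using poly_bounded_add[OF assms(1) poly_bounded_mult[OF poly_bounded_const[of "-1"] assms(2)]]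
  by simp

lemma poly_bounded_Suc:
  assumes "poly_bounded g"
  shows "poly_bounded (\<lambda>n. g (Suc n))"
proof -
  from assms obtain C k where g: "\<And>n. \<bar>g n\<bar> \<le> C * (real n + 1) ^ k"
    unfolding poly_bounded_def by blast
  have "C \<ge> 0" using g[of 0] by simp
  have "\<bar>g (Suc n)\<bar> \<le> (C * 2 ^ k) * (real n + 1) ^ k" for n
  proof -
    have "\<bar>g (Suc n)\<bar> \<le> C * (real (Suc n) + 1) ^ k" by (rule g)
    also have "\<dots> \<le> C * (2 * (real n + 1)) ^ k"
      using \<open>C \<ge> 0\<close> by (intro mult_left_mono power_mono) auto
    finally show ?thesis by (simp only: power_mult_distrib mult.assoc)
  qed
  then show ?thesis unfolding poly_bounded_def by blast
qed

lemma poly_bounded_ln: "poly_bounded (\<lambda>n. ln (real n))"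
proof (rule poly_bounded_mono[OF poly_bounded_real])
  fix n :: nat
  show "\<bar>ln (real n)\<bar> \<le> \<bar>real n\<bar>"
    \<comment> \<open>At \<open>n = 0\<close> the bound holds because
      \<open>ln 0 = 0\<close>.\<close>
    by (cases "n = 0") (auto intro: ln_bound)
qed

lemma poly_bounded_ln_Suc: "poly_bounded (\<lambda>n. ln (real n + 1))"
  using poly_bounded_Suc[OF poly_bounded_ln] by (simp add: add.commute)

lemma ln_fact_le: "ln (fact n :: real) \<le> real n * ln (real n)"
proof (cases "n = 0")
  case False
  have "(fact n :: real) \<le> real n ^ n"
    using fact_le_power[of n] by simp
  then have "ln (fact n :: real) \<le> ln (real n ^ n)"
    using False by (subst ln_le_cancel_iff) auto
  then show ?thesis using False by (simp add: ln_realpow)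
qed simp

lemma poly_bounded_ln_fact: "poly_bounded (\<lambda>n. ln (fact n))"
proof (rule poly_bounded_mono[OF poly_bounded_mult[OF poly_bounded_real poly_bounded_ln]])
  fix n :: nat
  show "\<bar>ln (fact n)\<bar> \<le> \<bar>real n * ln (real n)\<bar>"
    using ln_fact_le[of n] by (simp add: fact_ge_1)
qed

lemmas poly_bounded_intros = poly_bounded_const poly_bounded_real poly_bounded_add
  poly_bounded_mult poly_bounded_diff poly_bounded_ln poly_bounded_ln_Suc poly_bounded_ln_fact

section \<open>Weights and weighted sums\<close>

text \<open>What remains of the powered Poisson probability at parameter 1 once the factor
  \<open>exp (- \<alpha> * \<mu>)\<close>, which cancels in the entropy, is removed. The weights are
  not normalized.\<close>

definition wt :: "real \<Rightarrow> nat \<Rightarrow> real" where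
  "wt \<alpha> n = fact n powr (- \<alpha>)"

definition wsum :: "real \<Rightarrow> (nat \<Rightarrow> real) \<Rightarrow> real" where
  "wsum \<alpha> g = (\<Sum>n. g n * wt \<alpha> n)"

lemma wt_pos: "wt \<alpha> n > 0"
  by (simp add: wt_def)

lemma wt_le_1: "\<alpha> > 0 \<Longrightarrow> wt \<alpha> n \<le> 1"
  using ge_one_powr_ge_zero[of "fact n" \<alpha>] by (simp add: wt_def powr_minus field_simps)

lemma wt_Suc: "wt \<alpha> (Suc n) = wt \<alpha> n * (real n + 1) powr (- \<alpha>)"
  unfolding wt_def by (simp add: powr_mult add.commute mult.commute)

lemma poisson_powr_eq:
  assumes "\<mu> > 0"
  shows "pmf (poisson_pmf \<mu>) n powr \<alpha> = exp (- \<alpha> * \<mu>) * (wt \<alpha> n * (\<mu> powr \<alpha>) ^ n)"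
proof -
  have "pmf (poisson_pmf \<mu>) n powr \<alpha> = exp (\<alpha> * (real n * ln \<mu> - ln (fact n) - \<mu>))"
    using assms by (simp add: powr_def ln_div ln_mult ln_realpow)
  also have "\<dots> = exp (- \<alpha> * \<mu>) * (exp (- \<alpha> * ln (fact n)) * exp (real n * (\<alpha> * ln \<mu>)))"
    by (simp add: exp_add[symmetric] algebra_simps)
  finally show ?thesis
    using assms by (simp add: wt_def powr_def exp_of_nat_mult)
qed

text \<open>Every \<open>K > 0\<close> has the form \<open>\<mu> powr \<alpha>\<close> for a Poisson
  parameter \<open>\<mu>\<close>, so the summability of the powered Poisson distribution carries
  over.\<close>

lemma summable_wt_power:
  assumes "\<alpha> > 0" "K > 0"
  shows "summable (\<lambda>n. wt \<alpha> n * K ^ n)"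
proof -
  define \<mu> where "\<mu> = K powr (1 / \<alpha>)"
  have \<mu>: "\<mu> > 0" "\<mu> powr \<alpha> = K" using assms by (auto simp: \<mu>_def powr_powr)
  have "summable (\<lambda>n. exp (- \<alpha> * \<mu>) * (wt \<alpha> n * K ^ n))"
    using summable_poisson_powr[OF \<mu>(1) assms(1)] unfolding poisson_powr_eq[OF \<mu>(1)] \<mu>(2) .
  then have "summable (\<lambda>n. exp (\<alpha> * \<mu>) * (exp (- \<alpha> * \<mu>) * (wt \<alpha> n * K ^ n)))"
    by (rule summable_mult)
  then show ?thesis by (simp add: mult.assoc[symmetric] exp_add[symmetric])
qed

text \<open>Since \<open>n + 1 \<le> exp (n + 1)\<close>, a polynomial factor of degree
  \<open>k\<close> costs only a geometric factor \<open>exp k ^ n\<close>. Passing to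
  \<open>\<bar>K\<bar> + 1\<close> keeps the base positive for every real \<open>K\<close>.\<close>

lemma summable_poly_bounded_wt:
  assumes "\<alpha> > 0" "poly_bounded g"
  shows "summable (\<lambda>n. g n * wt \<alpha> n * K ^ n)"
proof -
  obtain C k where g: "\<And>n. \<bar>g n\<bar> \<le> C * (real n + 1) ^ k"
    using assms unfolding poly_bounded_def by blast
  have "C \<ge> 0" using g[of 0] by simp
  have "summable (\<lambda>n. C * exp (real k) * (wt \<alpha> n * (exp (real k) * (\<bar>K\<bar> + 1)) ^ n))"
    by (intro summable_mult summable_wt_power assms) (simp add: add_nonneg_pos)
  then show ?thesis
  proof (rule summable_comparison_test')
    fix n :: nat assume "n \<ge> 0"
    have "(real n + 1) ^ k \<le> exp (real n + 1) ^ k"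
      using exp_ge_add_one_self[of "real n + 1"] by (intro power_mono) auto
    also have "\<dots> = exp (real k) * exp (real k) ^ n"
      by (simp add: exp_add[symmetric] exp_of_nat_mult[symmetric] algebra_simps)
    finally have "\<bar>g n\<bar> \<le> C * (exp (real k) * exp (real k) ^ n)"
      using g[of n] \<open>C \<ge> 0\<close> by (meson mult_left_mono order_trans)
    then have "\<bar>g n\<bar> * (wt \<alpha> n * \<bar>K\<bar> ^ n)
        \<le> (C * (exp (real k) * exp (real k) ^ n)) * (wt \<alpha> n * (\<bar>K\<bar> + 1) ^ n)"
      using wt_pos[of \<alpha> n] \<open>C \<ge> 0\<close> by (intro mult_mono power_mono) auto
    then show "norm (g n * wt \<alpha> n * K ^ n)
        \<le> C * exp (real k) * (wt \<alpha> n * (exp (real k) * (\<bar>K\<bar> + 1)) ^ n)"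
      using wt_pos[of \<alpha> n] by (simp add: abs_mult power_abs power_mult_distrib mult_ac)
  qed
qed

lemma summable_wsum:
  assumes "\<alpha> > 0" "poly_bounded g"
  shows "summable (\<lambda>n. g n * wt \<alpha> n)"
  using summable_poly_bounded_wt[OF assms, of 1] by simp

lemma wsum_add:
  assumes "\<alpha> > 0" "poly_bounded f" "poly_bounded g"
  shows "wsum \<alpha> (\<lambda>n. f n + g n) = wsum \<alpha> f + wsum \<alpha> g"
  using suminf_add[OF summable_wsum[OF assms(1,2)] summable_wsum[OF assms(1,3)]]
  by (simp add: wsum_def distrib_right)

lemma wsum_diff:
  assumes "\<alpha> > 0" "poly_bounded f" "poly_bounded g"
  shows "wsum \<alpha> (\<lambda>n. f n - g n) = wsum \<alpha> f - wsum \<alpha> g"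
  using suminf_diff[OF summable_wsum[OF assms(1,2)] summable_wsum[OF assms(1,3)]]
  by (simp add: wsum_def left_diff_distrib)

lemma wsum_cmult:
  assumes "\<alpha> > 0" "poly_bounded f"
  shows "wsum \<alpha> (\<lambda>n. c * f n) = c * wsum \<alpha> f"
  using suminf_mult[OF summable_wsum[OF assms], of c]
  by (simp add: wsum_def mult.assoc)

lemma wsum_mono:
  assumes "\<alpha> > 0" "poly_bounded f" "poly_bounded g" "\<And>n. f n \<le> g n"
  shows "wsum \<alpha> f \<le> wsum \<alpha> g"
  unfolding wsum_def
  using assms wt_pos[of \<alpha>] by (intro suminf_le summable_wsum mult_right_mono) (auto intro: less_imp_le)

lemma wsum_nonneg:
  assumes "\<alpha> > 0" "poly_bounded f" "\<And>n. f n \<ge> 0"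
  shows "wsum \<alpha> f \<ge> 0"
  unfolding wsum_def
  using assms wt_pos[of \<alpha>] by (intro suminf_nonneg summable_wsum mult_nonneg_nonneg) (auto intro: less_imp_le)

section \<open>Summation by parts and elementary inequalities\<close>

text \<open>The relative drop from \<open>wt \<alpha> n\<close> to
  \<open>wt \<alpha> (Suc n)\<close>, called \<open>q n\<close> in the introduction.\<close>

definition drop_rate :: "real \<Rightarrow> nat \<Rightarrow> real" where
  "drop_rate \<alpha> n = 1 - (real n + 1) powr (- \<alpha>)"

lemma drop_rate_bounds:
  assumes "\<alpha> > 0"
  shows "0 \<le> drop_rate \<alpha> n" "drop_rate \<alpha> n \<le> 1"
  using assms ge_one_powr_ge_zero[of "real n + 1" \<alpha>]
  by (auto simp: drop_rate_def powr_minus field_simps)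

lemma poly_bounded_drop_rate: "\<alpha> > 0 \<Longrightarrow> poly_bounded (drop_rate \<alpha>)"
  by (rule poly_bounded_mono[OF poly_bounded_const[of 1]]) (simp add: drop_rate_bounds)

text \<open>Shift the index in \<open>wsum \<alpha> G\<close>: the head term vanishes by
  \<open>G 0 = 0\<close>, and each shifted weight is
  \<open>wt \<alpha> n * (1 - drop_rate \<alpha> n)\<close>.\<close>

lemma wsum_by_parts:
  assumes "\<alpha> > 0" "poly_bounded G" "G 0 = 0"
  shows "wsum \<alpha> (\<lambda>n. G (Suc n) * drop_rate \<alpha> n) = wsum \<alpha> (\<lambda>n. G (Suc n) - G n)"
proof -
  have G': "poly_bounded (\<lambda>n. G (Suc n))" by (rule poly_bounded_Suc) fact
  have q: "poly_bounded (\<lambda>n. 1 - drop_rate \<alpha> n)"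
    using poly_bounded_diff[OF poly_bounded_const poly_bounded_drop_rate[OF assms(1)]] .
  have "wsum \<alpha> G = (\<Sum>n. G (Suc n) * wt \<alpha> (Suc n))"
    using suminf_split_head[OF summable_wsum[OF assms(1,2)]] assms(3) by (simp add: wsum_def)
  also have "\<dots> = wsum \<alpha> (\<lambda>n. G (Suc n) * (1 - drop_rate \<alpha> n))"
    unfolding wsum_def by (simp add: wt_Suc drop_rate_def mult_ac)
  also have "\<dots> = wsum \<alpha> (\<lambda>n. G (Suc n)) - wsum \<alpha> (\<lambda>n. G (Suc n) * drop_rate \<alpha> n)"
    using wsum_diff[OF assms(1) G' poly_bounded_mult[OF G' poly_bounded_drop_rate[OF assms(1)]]]
    by (simp add: algebra_simps)
  finally show ?thesis using wsum_diff[OF assms(1) G' assms(2)] by simp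
qed

lemma ln_Suc_step_le: "real n * (ln (real n + 1) - ln (real n)) \<le> 1"
proof (cases "n = 0")
  case False
  then have "ln (real n + 1) - ln (real n) \<le> 1 / real n"
    using ln_diff_le[of "real n + 1" "real n"] by simp
  then show ?thesis using False by (simp add: field_simps)
qed simp

lemma ln_Suc_step_ge:
  assumes "n > 0"
  shows "1 \<le> (real n + 1) * (ln (real n + 1) - ln (real n))"
proof -
  have "ln (real n) - ln (real n + 1) \<le> - 1 / (real n + 1)"
    using ln_diff_le[of "real n" "real n + 1"] assms by simp
  then show ?thesis by (simp add: field_simps)
qed

text \<open>As \<open>drop_rate \<alpha> n = 1 - exp (- t n)\<close>, both bounds are
  \<open>1 + x \<le> exp x\<close>, at \<open>x = - t n\<close> and at \<open>x = t n\<close>. In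
  the second, the error of the first-order approximation carries a factor
  \<open>drop_rate \<alpha> n\<close>, which makes it accessible to summation by parts.\<close>

lemma log_drop_bounds:
  assumes "\<alpha> > 0"
  defines "t \<equiv> \<lambda>n. \<alpha> * ln (real n + 1)"
  shows "drop_rate \<alpha> n \<le> t n" "t n - drop_rate \<alpha> n \<le> t n * drop_rate \<alpha> n"
proof -
  have q: "drop_rate \<alpha> n = 1 - exp (- t n)"
    by (simp add: drop_rate_def powr_def t_def)
  show "drop_rate \<alpha> n \<le> t n"
    using exp_ge_add_one_self[of "- t n"] by (simp add: q)
  have "exp (- t n) * (1 + t n) \<le> exp (- t n) * exp (t n)"
    by (intro mult_left_mono exp_ge_add_one_self) auto
  then show "t n - drop_rate \<alpha> n \<le> t n * drop_rate \<alpha> n"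
    by (simp add: q exp_minus_inverse algebra_simps exp_minus)
qed

text \<open>The increment at \<open>n\<close> is
  \<open>(n + 2) * (ln (n + 2) - ln (n + 1)) - 1\<close>, nonnegative by
  \<open>ln_Suc_step_ge\<close>.\<close>

lemma stirling_gap_mono:
  assumes "m \<le> n"
  shows "(real m + 1) * ln (real m + 1) - ln (fact m) - real m
    \<le> (real n + 1) * ln (real n + 1) - ln (fact n) - real n"
  using assms
proof (induction n rule: dec_induct)
  case (step n)
  have "ln (fact (Suc n) :: real) = ln (real n + 1) + ln (fact n)"
    by (simp add: ln_mult add.commute)
  moreover have "1 \<le> (real (Suc n) + 1) * (ln (real (Suc n) + 1) - ln (real n + 1))"
    using ln_Suc_step_ge[of "Suc n"] by (simp add: add.commute)
  ultimately show ?case using step.IH by (simp add: algebra_simps)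
qed simp

text \<open>Chebyshev's covariance inequality. Centering allows subtracting the constant
  \<open>\<phi> k\<close>, with \<open>k\<close> the integer part of \<open>m\<close>; then both
  factors have the same sign for every \<open>n\<close>.\<close>

lemma wsum_centered_mono_nonneg:
  assumes "\<alpha> > 0" "poly_bounded \<phi>" "mono \<phi>" "m \<ge> 0" "wsum \<alpha> (\<lambda>n. real n - m) = 0"
  shows "wsum \<alpha> (\<lambda>n. \<phi> n * (real n - m)) \<ge> 0"
proof -
  define k where "k = nat \<lfloor>m\<rfloor>"
  have k: "real k \<le> m" "m < real k + 1"
    using assms(4) unfolding k_def by linarith+
  have "(\<phi> n - \<phi> k) * (real n - m) \<ge> 0" for n
  proof (cases "n \<le> k")
    case True
    then show ?thesis using k monoD[OF assms(3), of n k] by (intro mult_nonpos_nonpos) auto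
  next
    case False
    then have "real n \<ge> real k + 1" by linarith
    then show ?thesis using k monoD[OF assms(3), of k n] False by (intro mult_nonneg_nonneg) auto
  qed
  then have "0 \<le> wsum \<alpha> (\<lambda>n. (\<phi> n - \<phi> k) * (real n - m))"
    using assms by (intro wsum_nonneg poly_bounded_intros)
  also have "\<dots> = wsum \<alpha> (\<lambda>n. \<phi> n * (real n - m)) - wsum \<alpha> (\<lambda>n. \<phi> k * (real n - m))"
    unfolding left_diff_distrib using assms
    by (intro wsum_diff poly_bounded_intros)
  also have "wsum \<alpha> (\<lambda>n. \<phi> k * (real n - m)) = \<phi> k * wsum \<alpha> (\<lambda>n. real n - m)"
    using assms by (intro wsum_cmult poly_bounded_intros)
  finally show ?thesis using assms(5) by simp
qed

section \<open>Moments involving the drop rate\<close>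

text \<open>Summation by parts for \<open>G n = n\<close> and \<open>G n = n * (n - 1)\<close>.
  Together they give the covariance of \<open>(N + 1) * q N\<close> with \<open>N\<close>
  exactly.\<close>

lemma wsum_drop_moments:
  assumes "\<alpha> > 0"
  shows "wsum \<alpha> (\<lambda>n. (real n + 1) * drop_rate \<alpha> n) = wsum \<alpha> (\<lambda>n. 1)"
    and "wsum \<alpha> (\<lambda>n. (real n + 1) * real n * drop_rate \<alpha> n) = 2 * wsum \<alpha> real"
proof -
  show "wsum \<alpha> (\<lambda>n. (real n + 1) * drop_rate \<alpha> n) = wsum \<alpha> (\<lambda>n. 1)"
    using wsum_by_parts[OF assms poly_bounded_real] by (simp add: add.commute)
  have "wsum \<alpha> (\<lambda>n. (real n + 1) * real n * drop_rate \<alpha> n) = wsum \<alpha> (\<lambda>n. 2 * real n)"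
    using wsum_by_parts[OF assms, of "\<lambda>n. real n * (real n - 1)"]
    by (simp add: poly_bounded_intros algebra_simps)
  then show "wsum \<alpha> (\<lambda>n. (real n + 1) * real n * drop_rate \<alpha> n) = 2 * wsum \<alpha> real"
    using wsum_cmult[OF assms poly_bounded_real] by simp
qed

text \<open>The second estimate controls the error of the approximation. Summation by parts reduces
  it to the sum of \<open>2 * n * t n\<close>, up to \<open>\<alpha> * n\<close>, hence to the first
  estimate. There \<open>log_drop_bounds\<close> splits \<open>n * t n\<close> into a part with
  known sum and \<open>n * t n * drop_rate \<alpha> n\<close>, which is summed by parts
  again.\<close>

lemma wsum_log_drop_moments:
  assumes "\<alpha> > 0"
  defines "t \<equiv> \<lambda>n. \<alpha> * ln (real n + 1)"
  shows "wsum \<alpha> (\<lambda>n. real n * t n) \<le> (1 + \<alpha>) * wsum \<alpha> (\<lambda>n. 1) + \<alpha> * wsum \<alpha> real"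
    and "wsum \<alpha> (\<lambda>n. (real n + 1) * real n * t n * drop_rate \<alpha> n)
      \<le> (2 + 2 * \<alpha>) * wsum \<alpha> (\<lambda>n. 1) + 3 * \<alpha> * wsum \<alpha> real"
proof -
  note q = poly_bounded_drop_rate[OF assms(1)]
  have t: "poly_bounded t" unfolding t_def by (intro poly_bounded_intros)
  note pb = poly_bounded_intros q t
  have step: "real n * (t n - \<alpha> * ln (real n)) \<le> \<alpha>" for n
    using mult_left_mono[OF ln_Suc_step_le[of n], of \<alpha>] assms
    by (simp add: t_def algebra_simps)
  \<comment> \<open>The function summed by parts has the factor \<open>real n - 1 = -1\<close> at 0
    but still vanishes there, because \<open>ln 0 = 0\<close>.\<close>
  have "wsum \<alpha> (\<lambda>n. real n * t n * drop_rate \<alpha> n)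
      = wsum \<alpha> (\<lambda>n. real n * t n - (real n - 1) * (\<alpha> * ln (real n)))"
    using wsum_by_parts[OF assms(1), of "\<lambda>n. (real n - 1) * (\<alpha> * ln (real n))"]
    by (simp add: poly_bounded_intros t_def add.commute)
  also have "\<dots> \<le> wsum \<alpha> (\<lambda>n. \<alpha> * (real n + 1))"
  proof (intro wsum_mono pb assms)
    fix n :: nat
    have "\<alpha> * ln (real n) \<le> \<alpha> * real n"
      using assms by (cases "n = 0") (auto intro!: mult_left_mono ln_bound)
    then show "real n * t n - (real n - 1) * (\<alpha> * ln (real n)) \<le> \<alpha> * (real n + 1)"
      using step[of n] by (simp add: algebra_simps)
  qed
  also have "\<dots> = \<alpha> * (wsum \<alpha> real + wsum \<alpha> (\<lambda>n. 1))"
    using wsum_cmult[OF assms(1), of "\<lambda>n. real n + 1"] wsum_add[OF assms(1), of real "\<lambda>n. 1"]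
    by (simp add: pb)
  finally have 1: "wsum \<alpha> (\<lambda>n. real n * t n * drop_rate \<alpha> n) \<le> \<alpha> * (wsum \<alpha> real + wsum \<alpha> (\<lambda>n. 1))" .
  have "wsum \<alpha> (\<lambda>n. real n * t n)
      \<le> wsum \<alpha> (\<lambda>n. (real n + 1) * drop_rate \<alpha> n + real n * t n * drop_rate \<alpha> n)"
  proof (intro wsum_mono pb assms)
    fix n
    have "real n * (t n - drop_rate \<alpha> n) \<le> real n * (t n * drop_rate \<alpha> n)"
      unfolding t_def by (intro mult_left_mono log_drop_bounds assms) auto
    then show "real n * t n \<le> (real n + 1) * drop_rate \<alpha> n + real n * t n * drop_rate \<alpha> n"
      using drop_rate_bounds(1)[OF assms(1), of n] by (simp add: algebra_simps)
  qed
  also have "\<dots> = wsum \<alpha> (\<lambda>n. (real n + 1) * drop_rate \<alpha> n) + wsum \<alpha> (\<lambda>n. real n * t n * drop_rate \<alpha> n)"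
    by (intro wsum_add pb assms)
  finally show 2: "wsum \<alpha> (\<lambda>n. real n * t n) \<le> (1 + \<alpha>) * wsum \<alpha> (\<lambda>n. 1) + \<alpha> * wsum \<alpha> real"
    using 1 wsum_drop_moments(1)[OF assms(1)] by (simp add: algebra_simps)
  have "wsum \<alpha> (\<lambda>n. (real n + 1) * real n * t n * drop_rate \<alpha> n)
      = wsum \<alpha> (\<lambda>n. (real n + 1) * real n * t n - real n * (real n - 1) * (\<alpha> * ln (real n)))"
    using wsum_by_parts[OF assms(1), of "\<lambda>n. real n * (real n - 1) * (\<alpha> * ln (real n))"]
    by (simp add: poly_bounded_intros t_def add.commute)
  also have "\<dots> \<le> wsum \<alpha> (\<lambda>n. 2 * (real n * t n) + \<alpha> * real n)"
  proof (intro wsum_mono pb assms)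
    fix n :: nat
    show "(real n + 1) * real n * t n - real n * (real n - 1) * (\<alpha> * ln (real n))
        \<le> 2 * (real n * t n) + \<alpha> * real n"
    proof (cases "n = 0")
      case False
      then have "(real n - 1) * (real n * (t n - \<alpha> * ln (real n))) \<le> (real n - 1) * \<alpha>"
        by (intro mult_left_mono step) auto
      then show ?thesis using assms by (simp add: algebra_simps)
    qed simp
  qed
  also have "\<dots> = 2 * wsum \<alpha> (\<lambda>n. real n * t n) + \<alpha> * wsum \<alpha> real"
    using wsum_add[OF assms(1), of "\<lambda>n. 2 * (real n * t n)" "\<lambda>n. \<alpha> * real n"]
      wsum_cmult[OF assms(1), of "\<lambda>n. real n * t n" 2] wsum_cmult[OF assms(1), of real \<alpha>]
    by (simp add: pb)
  finally show "wsum \<alpha> (\<lambda>n. (real n + 1) * real n * t n * drop_rate \<alpha> n)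
      \<le> (2 + 2 * \<alpha>) * wsum \<alpha> (\<lambda>n. 1) + 3 * \<alpha> * wsum \<alpha> real"
    using 2 by (simp add: algebra_simps)
qed

text \<open>For \<open>n \<ge> 1\<close> the drop rate is at least \<open>\<alpha> / 3\<close>,
  because \<open>ln 2 \<ge> 1 / 2\<close>. So \<open>\<alpha> / 3 * n\<close> lies below
  \<open>(n + 1) * drop_rate \<alpha> n\<close>, whose weighted sum is the total mass.\<close>

lemma mean_bound:
  assumes "0 < \<alpha>" "\<alpha> < 1"
  shows "\<alpha> * wsum \<alpha> real \<le> 3 * wsum \<alpha> (\<lambda>n. 1)"
proof -
  note pb = poly_bounded_intros poly_bounded_drop_rate[OF assms(1)]
  have "wsum \<alpha> (\<lambda>n. \<alpha> / 3 * real n) \<le> wsum \<alpha> (\<lambda>n. (real n + 1) * drop_rate \<alpha> n)"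
  proof (intro wsum_mono pb assms)
    fix n :: nat
    show "\<alpha> / 3 * real n \<le> (real n + 1) * drop_rate \<alpha> n"
    proof (cases "n = 0")
      case True
      then show ?thesis using drop_rate_bounds(1)[OF assms(1), of n] by simp
    next
      case False
      have "1 / 2 \<le> ln (2 :: real)" using ln2_ge_two_thirds by simp
      also have "\<dots> \<le> ln (real n + 1)" using False by simp
      finally have "\<alpha> / 2 \<le> \<alpha> * ln (real n + 1)"
        using mult_left_mono[of "1/2" "ln (real n + 1)" \<alpha>] assms by simp
      then have "(real n + 1) powr (- \<alpha>) \<le> exp (- (\<alpha> / 2))"
        by (simp add: powr_def)
      also have "\<dots> \<le> 1 / (1 + \<alpha> / 2)"
        using exp_ge_add_one_self[of "\<alpha> / 2"] assms
        by (simp add: exp_minus field_simps)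
      \<comment> \<open>Clearing denominators leaves
        \<open>\<alpha> * \<alpha> \<le> \<alpha>\<close>, which is where
        \<open>\<alpha> < 1\<close> enters.\<close>
      also have "\<dots> \<le> 1 - \<alpha> / 3"
        using assms mult_strict_left_mono[of \<alpha> 1 \<alpha>] by (simp add: field_simps)
      finally have "\<alpha> / 3 \<le> drop_rate \<alpha> n" by (simp add: drop_rate_def)
      then have "real n * (\<alpha> / 3) \<le> real n * drop_rate \<alpha> n" by (intro mult_left_mono) auto
      then show ?thesis
        using drop_rate_bounds(1)[OF assms(1), of n] by (simp add: algebra_simps)
    qed
  qed
  then show ?thesis
    using wsum_cmult[OF assms(1) poly_bounded_real, of "\<alpha> / 3"] wsum_drop_moments(1)[OF assms(1)]
    by simp
qed

section \<open>Lower bounds for the variance and the total mass\<close>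

lemma card_near_le:
  assumes "m \<ge> 0" "K \<ge> 0"
  defines "I \<equiv> {n :: nat. \<bar>real n - m\<bar> < K}"
  shows "finite I" "real (card I) \<le> 2 * K + 1"
proof -
  let ?J = "{nat \<lceil>m - K\<rceil>..nat \<lfloor>m + K\<rfloor>}"
  have sub: "I \<subseteq> ?J"
  proof
    fix n assume "n \<in> I"
    then have "m - K < real n" "real n < m + K" by (auto simp: I_def)
    moreover from this have "int n \<le> \<lfloor>m + K\<rfloor>" by linarith
    ultimately show "n \<in> ?J" by auto
  qed
  then show "finite I" by (rule finite_subset) simp
  have "card I \<le> card ?J" using sub by (intro card_mono) auto
  moreover have "real (card ?J) \<le> 2 * K + 1"
    using assms(1,2) by simp linarith
  ultimately show "real (card I) \<le> 2 * K + 1" by linarith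
qed

text \<open>All weights are at most 1, so little of the total mass \<open>Z\<close> lies within \<open>Z / 8\<close> of any
  point.\<close>

lemma variance_lower_bound:
  assumes "\<alpha> > 0" "m \<ge> 0"
  defines "Z \<equiv> wsum \<alpha> (\<lambda>n. 1)"
  assumes "Z \<ge> 4"
  shows "Z ^ 3 / 128 \<le> wsum \<alpha> (\<lambda>n. (real n - m)\<^sup>2)"
proof -
  define K where "K = Z / 8"
  define I where "I = {n :: nat. \<bar>real n - m\<bar> < K}"
  have K: "K \<ge> 0" using assms by (simp add: K_def)
  note I = card_near_le[OF assms(2) K, folded I_def]
  have bI: "poly_bounded (\<lambda>n. of_bool (n \<in> I))"
    by (rule poly_bounded_mono[OF poly_bounded_const[of 1]]) auto
  note pb = poly_bounded_intros bI
  have "wsum \<alpha> (\<lambda>n. of_bool (n \<in> I)) = (\<Sum>n\<in>I. wt \<alpha> n)"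
    unfolding wsum_def by (subst suminf_finite[OF I(1)]) auto
  also have "\<dots> \<le> (\<Sum>n\<in>I. 1)"
    by (intro sum_mono wt_le_1 assms)
  finally have near: "wsum \<alpha> (\<lambda>n. of_bool (n \<in> I)) \<le> 2 * K + 1" using I(2) by simp
  have "K\<^sup>2 * (Z - (2 * K + 1)) \<le> K\<^sup>2 * (Z - wsum \<alpha> (\<lambda>n. of_bool (n \<in> I)))"
    using near by (intro mult_left_mono) auto
  also have "\<dots> = wsum \<alpha> (\<lambda>n. K\<^sup>2 * (1 - of_bool (n \<in> I)))"
    using wsum_cmult[OF assms(1), of "\<lambda>n. 1 - of_bool (n \<in> I)" "K\<^sup>2"]
      wsum_diff[OF assms(1) _ bI, of "\<lambda>n. 1"] by (simp add: pb Z_def)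
  also have "\<dots> \<le> wsum \<alpha> (\<lambda>n. (real n - m)\<^sup>2)"
    unfolding power2_eq_square
  proof (intro wsum_mono pb assms)
    fix n
    show "K * K * (1 - of_bool (n \<in> I)) \<le> (real n - m) * (real n - m)"
      using K abs_le_square_iff[of K "real n - m"]
      by (cases "n \<in> I") (auto simp: I_def power2_eq_square)
  qed
  finally have "K\<^sup>2 * (Z - (2 * K + 1)) \<le> wsum \<alpha> (\<lambda>n. (real n - m)\<^sup>2)" .
  \<comment> \<open>By \<open>Z \<ge> 4\<close> the mass outside \<open>I\<close> is at least
    \<open>Z - (Z / 4 + 1) \<ge> Z / 2\<close>; multiplied by
    \<open>K\<^sup>2 = Z\<^sup>2 / 64\<close> this gives the constant 128.\<close>
  moreover have "Z\<^sup>2 * 4 \<le> Z\<^sup>2 * Z" using assms by (intro mult_left_mono) auto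
  ultimately show ?thesis
    by (simp add: K_def power2_eq_square power3_eq_cube algebra_simps)
qed

text \<open>The exponent \<open>- 2 / 3\<close> makes \<open>\<alpha> n ln n\<close> bounded for \<open>n\<close> up to \<open>\<alpha> powr (- 2 / 3)\<close>, because
  \<open>ln n \<le> 2 sqrt n\<close>.\<close>

lemma total_weight_lower_bound:
  assumes "\<alpha> > 0"
  shows "\<alpha> powr (- 2 / 3) * exp (- 2) \<le> wsum \<alpha> (\<lambda>n. 1)"
proof -
  define y where "y = \<alpha> powr (- 2 / 3)"
  \<comment> \<open>\<open>N\<close> is the number of naturals \<open>n\<close> with
    \<open>n \<le> y\<close>, and it is itself at least \<open>y\<close>.\<close>
  define N where "N = Suc (nat \<lfloor>y\<rfloor>)"
  have y: "y \<ge> 0" by (simp add: y_def)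
  have N: "y \<le> real N" unfolding N_def using y by linarith
  have ysqrt: "\<alpha> * (y * sqrt y) = 1"
  proof -
    have "y * sqrt y = \<alpha> powr (- 2 / 3) * \<alpha> powr (- 1 / 3)"
      using y by (simp add: y_def powr_half_sqrt[symmetric] powr_powr)
    also have "\<dots> = \<alpha> powr (- 1)" by (simp flip: powr_add)
    finally show ?thesis using assms by (simp add: powr_minus)
  qed
  have "exp (- 2) \<le> wt \<alpha> n" if "n < N" for n
  proof (cases "n = 0")
    case True
    then show ?thesis by (simp add: wt_def)
  next
    case False
    have "real n \<le> y" using that y unfolding N_def by linarith
    have "ln (real n) = 2 * ln (sqrt (real n))" using False by (simp add: ln_sqrt)
    also have "\<dots> \<le> 2 * sqrt (real n)" using False by (intro mult_left_mono ln_bound) auto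
    also have "\<dots> \<le> 2 * sqrt y" using \<open>real n \<le> y\<close> by simp
    finally have "real n * ln (real n) \<le> y * (2 * sqrt y)"
      using \<open>real n \<le> y\<close> y False by (intro mult_mono) auto
    then have "ln (fact n) \<le> y * (2 * sqrt y)" using ln_fact_le[of n] by linarith
    then have "\<alpha> * ln (fact n) \<le> \<alpha> * (y * (2 * sqrt y))" using assms by (intro mult_left_mono) auto
    also have "\<dots> = 2" using ysqrt by (simp add: algebra_simps)
    finally show ?thesis by (simp add: wt_def powr_def)
  qed
  then have "(\<Sum>n<N. exp (- 2)) \<le> (\<Sum>n<N. wt \<alpha> n)" by (intro sum_mono) auto
  also have "\<dots> \<le> wsum \<alpha> (\<lambda>n. 1)"
    unfolding wsum_def mult_1
    using summable_wsum[OF assms poly_bounded_const[of 1]] wt_pos[of \<alpha>]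
    by (intro sum_le_suminf) (auto intro: less_imp_le)
  finally have "real N * exp (- 2) \<le> wsum \<alpha> (\<lambda>n. 1)" by simp
  moreover have "y * exp (- 2) \<le> real N * exp (- 2)"
    using N by (intro mult_right_mono) auto
  ultimately show ?thesis unfolding y_def by linarith
qed

section \<open>Upper bound for the derivative at 1\<close>

text \<open>Divided by \<open>Z\<close>, the left side is the derivative of the entropy at parameter
  1. The sums are left unnormalized throughout.\<close>

lemma covariance_upper_bound:
  assumes "0 < \<alpha>" "\<alpha> < 1"
  defines "Z \<equiv> wsum \<alpha> (\<lambda>n. 1)" and "M \<equiv> wsum \<alpha> real"
  defines "m \<equiv> M / Z"
  assumes "Z > 0"
  shows "Z - M + \<alpha> * wsum \<alpha> (\<lambda>n. ln (fact n) * (real n - m))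
    \<le> 14 * Z - \<alpha> * wsum \<alpha> (\<lambda>n. (real n - m)\<^sup>2)"
proof -
  define t where "t = (\<lambda>n. \<alpha> * ln (real n + 1))"
  define \<phi> where "\<phi> = (\<lambda>n. (real n + 1) * ln (real n + 1) - ln (fact n) - real n)"
  define r where "r = (\<lambda>n. t n - drop_rate \<alpha> n)"
  note q = poly_bounded_drop_rate[OF assms(1)]
  have t: "poly_bounded t" unfolding t_def by (intro poly_bounded_intros)
  have r: "poly_bounded r" unfolding r_def by (intro poly_bounded_diff t q)
  have \<phi>: "poly_bounded \<phi>" unfolding \<phi>_def by (intro poly_bounded_intros)
  note pb = poly_bounded_intros q t r \<phi>
  have M0: "M \<ge> 0" unfolding M_def by (intro wsum_nonneg pb assms) auto
  have m0: "m \<ge> 0" using M0 assms by (simp add: m_def)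
  have centered: "wsum \<alpha> (\<lambda>n. real n - m) = 0"
    using wsum_diff[OF assms(1), of real "\<lambda>n. m"] wsum_cmult[OF assms(1), of "\<lambda>n. 1" m] assms(6)
    by (simp add: pb m_def Z_def M_def)
  have variance: "wsum \<alpha> (\<lambda>n. real n * (real n - m)) = wsum \<alpha> (\<lambda>n. (real n - m)\<^sup>2)"
  proof -
    have "wsum \<alpha> (\<lambda>n. (real n - m)\<^sup>2) = wsum \<alpha> (\<lambda>n. real n * (real n - m) - m * (real n - m))"
      by (simp add: power2_eq_square left_diff_distrib)
    also have "\<dots> = wsum \<alpha> (\<lambda>n. real n * (real n - m)) - wsum \<alpha> (\<lambda>n. m * (real n - m))"
      by (intro wsum_diff pb assms)
    also have "wsum \<alpha> (\<lambda>n. m * (real n - m)) = 0"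
      using wsum_cmult[OF assms(1), of "\<lambda>n. real n - m" m] centered by (simp add: pb)
    finally show ?thesis by simp
  qed
  have mono: "mono \<phi>"
    using stirling_gap_mono by (auto simp: mono_def \<phi>_def)
  have \<phi>cov: "wsum \<alpha> (\<lambda>n. \<phi> n * (real n - m)) \<ge> 0"
    by (rule wsum_centered_mono_nonneg[OF assms(1) \<phi> mono m0 centered])
  have "wsum \<alpha> (\<lambda>n. ln (fact n) * (real n - m))
      = wsum \<alpha> (\<lambda>n. (real n + 1) * ln (real n + 1) * (real n - m) - real n * (real n - m)
          - \<phi> n * (real n - m))"
    by (rule arg_cong[where f = "wsum \<alpha>"]) (auto simp: \<phi>_def algebra_simps)
  also have "\<dots> = wsum \<alpha> (\<lambda>n. (real n + 1) * ln (real n + 1) * (real n - m) - real n * (real n - m))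
      - wsum \<alpha> (\<lambda>n. \<phi> n * (real n - m))"
    by (intro wsum_diff pb assms)
  also have "wsum \<alpha> (\<lambda>n. (real n + 1) * ln (real n + 1) * (real n - m) - real n * (real n - m))
      = wsum \<alpha> (\<lambda>n. (real n + 1) * ln (real n + 1) * (real n - m))
        - wsum \<alpha> (\<lambda>n. real n * (real n - m))"
    by (intro wsum_diff pb assms)
  finally have "wsum \<alpha> (\<lambda>n. ln (fact n) * (real n - m))
      \<le> wsum \<alpha> (\<lambda>n. (real n + 1) * ln (real n + 1) * (real n - m))
        - wsum \<alpha> (\<lambda>n. (real n - m)\<^sup>2)"
    using \<phi>cov variance by linarith
  then have 1: "\<alpha> * wsum \<alpha> (\<lambda>n. ln (fact n) * (real n - m))
      \<le> \<alpha> * wsum \<alpha> (\<lambda>n. (real n + 1) * ln (real n + 1) * (real n - m))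
        - \<alpha> * wsum \<alpha> (\<lambda>n. (real n - m)\<^sup>2)"
    using mult_left_mono[of _ _ \<alpha>] assms(1) by (fastforce simp: right_diff_distrib)
  have "\<alpha> * wsum \<alpha> (\<lambda>n. (real n + 1) * ln (real n + 1) * (real n - m))
      = wsum \<alpha> (\<lambda>n. \<alpha> * ((real n + 1) * ln (real n + 1) * (real n - m)))"
    by (intro wsum_cmult[symmetric] pb assms)
  \<comment> \<open>Here \<open>\<alpha> * ln (n + 1)\<close> is split into
    \<open>drop_rate \<alpha> n + r n\<close>. The first part contributes exactly \<open>M\<close>,
    which cancels the \<open>- M\<close> of the claim.\<close>
  also have "\<dots> = wsum \<alpha> (\<lambda>n. (real n + 1) * real n * drop_rate \<alpha> n
      - m * ((real n + 1) * drop_rate \<alpha> n) + (real n + 1) * r n * (real n - m))"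
    by (rule arg_cong[where f = "wsum \<alpha>"]) (auto simp: r_def t_def algebra_simps)
  also have "\<dots> = wsum \<alpha> (\<lambda>n. (real n + 1) * real n * drop_rate \<alpha> n
      - m * ((real n + 1) * drop_rate \<alpha> n)) + wsum \<alpha> (\<lambda>n. (real n + 1) * r n * (real n - m))"
    by (intro wsum_add pb assms)
  also have "wsum \<alpha> (\<lambda>n. (real n + 1) * real n * drop_rate \<alpha> n - m * ((real n + 1) * drop_rate \<alpha> n))
      = 2 * M - m * Z"
    using wsum_diff[OF assms(1), of "\<lambda>n. (real n + 1) * real n * drop_rate \<alpha> n"
        "\<lambda>n. m * ((real n + 1) * drop_rate \<alpha> n)"]
      wsum_cmult[OF assms(1), of "\<lambda>n. (real n + 1) * drop_rate \<alpha> n" m]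
      wsum_drop_moments[OF assms(1)]
    by (simp add: pb M_def Z_def)
  also have "2 * M - m * Z = M" using assms by (simp add: m_def)
  also have "wsum \<alpha> (\<lambda>n. (real n + 1) * r n * (real n - m))
      \<le> wsum \<alpha> (\<lambda>n. (real n + 1) * real n * t n * drop_rate \<alpha> n)"
  proof (intro wsum_mono pb assms)
    fix n
    have r0: "0 \<le> r n" and r1: "r n \<le> t n * drop_rate \<alpha> n"
      using log_drop_bounds[OF assms(1), of n] by (auto simp: r_def t_def)
    have "(real n + 1) * r n * (real n - m) \<le> (real n + 1) * r n * real n"
      using r0 m0 by (intro mult_left_mono) auto
    also have "\<dots> = (real n + 1) * real n * r n" by simp
    also have "\<dots> \<le> (real n + 1) * real n * (t n * drop_rate \<alpha> n)"
      using r1 by (intro mult_left_mono) auto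
    finally show "(real n + 1) * r n * (real n - m) \<le> (real n + 1) * real n * t n * drop_rate \<alpha> n"
      by (simp add: mult_ac)
  qed
  also have "\<dots> \<le> (2 + 2 * \<alpha>) * Z + 3 * \<alpha> * M"
    using wsum_log_drop_moments(2)[OF assms(1)] by (simp add: t_def Z_def M_def)
  \<comment> \<open>The 4 comes from \<open>\<alpha> < 1\<close>, the 9 from
    \<open>mean_bound\<close>; with the leading \<open>Z\<close> of the claim this adds up to
    14.\<close>
  also have "\<dots> \<le> 4 * Z + 9 * Z"
    using mean_bound[OF assms(1,2)] mult_right_mono[of \<alpha> 1 Z] assms
    by (intro add_mono) (auto simp: Z_def M_def intro!: mult_right_mono)
  finally show ?thesis using 1 by linarith
qed

section \<open>The entropy as a function of the Poisson parameter\<close>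

text \<open>Up to \<open>exp (- \<alpha> * \<mu>)\<close>, the sum of \<open>g\<close> against the
  powered Poisson probabilities, arranged as a power series in \<open>\<mu> powr \<alpha>\<close> so
  that it can be differentiated termwise.\<close>

definition wseries :: "real \<Rightarrow> (nat \<Rightarrow> real) \<Rightarrow> real \<Rightarrow> real" where
  "wseries \<alpha> g \<mu> = (\<Sum>n. g n * wt \<alpha> n * (\<mu> powr \<alpha>) ^ n)"

lemma wseries_1: "wseries \<alpha> g 1 = wsum \<alpha> g"
  by (simp add: wseries_def wsum_def)

lemma wseries_const_pos:
  assumes "\<alpha> > 0" "\<mu> > 0"
  shows "wseries \<alpha> (\<lambda>n. 1) \<mu> > 0"
  unfolding wseries_def
  using assms wt_pos[of \<alpha>] by (intro suminf_pos summable_poly_bounded_wt poly_bounded_const) auto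

text \<open>With \<open>x = \<mu> powr \<alpha>\<close>, the operator \<open>x d/dx\<close>
  multiplies the \<open>n\<close>-th coefficient by \<open>n\<close>, and the derivative of
  \<open>x\<close> in \<open>\<mu>\<close> is \<open>\<alpha> / \<mu> * x\<close>.\<close>

lemma has_real_derivative_wseries:
  assumes "\<alpha> > 0" "poly_bounded g" "\<mu> > 0"
  shows "(wseries \<alpha> g has_real_derivative \<alpha> / \<mu> * wseries \<alpha> (\<lambda>n. real n * g n) \<mu>) (at \<mu>)"
proof -
  define c where "c = (\<lambda>n. g n * wt \<alpha> n)"
  define x where "x = \<mu> powr \<alpha>"
  have x: "x > 0" using assms by (simp add: x_def)
  have s: "summable (\<lambda>n. c n * y ^ n)" for y
    unfolding c_def by (rule summable_poly_bounded_wt) fact+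
  have d: "((\<lambda>x. \<Sum>n. c n * x ^ n) has_real_derivative (\<Sum>n. diffs c n * x ^ n)) (at x)"
    by (rule termdiffs_strong_converges_everywhere[OF s])
  have "(\<lambda>n. real n * c n * x ^ (n - Suc 0)) sums (\<Sum>n. diffs c n * x ^ n)"
    by (rule diffs_equiv[OF termdiff_converges_all[OF s]])
  then have "(\<lambda>n. x * (real n * c n * x ^ (n - Suc 0))) sums (x * (\<Sum>n. diffs c n * x ^ n))"
    by (rule sums_mult)
  \<comment> \<open>At \<open>n = 0\<close> the truncated exponent does no harm, since the factor
    \<open>real n\<close> is 0.\<close>
  moreover have "x * (real n * c n * x ^ (n - Suc 0)) = real n * g n * wt \<alpha> n * x ^ n" for n
    by (cases n) (auto simp: c_def)
  ultimately have "(\<lambda>n. real n * g n * wt \<alpha> n * x ^ n) sums (x * (\<Sum>n. diffs c n * x ^ n))"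
    by (simp only:)
  then have eq: "x * (\<Sum>n. diffs c n * x ^ n) = wseries \<alpha> (\<lambda>n. real n * g n) \<mu>"
    unfolding wseries_def x_def[symmetric] by (rule sums_unique)
  have p: "((\<lambda>\<mu>. \<mu> powr \<alpha>) has_real_derivative \<alpha> * \<mu> powr (\<alpha> - 1)) (at \<mu>)"
    using assms(3) by (rule has_real_derivative_powr)
  have "((\<lambda>\<mu>. \<Sum>n. c n * (\<mu> powr \<alpha>) ^ n) has_real_derivative
      (\<Sum>n. diffs c n * x ^ n) * (\<alpha> * \<mu> powr (\<alpha> - 1))) (at \<mu>)"
    using DERIV_chain2[OF d[unfolded x_def] p] by (simp add: x_def)
  also have "(\<Sum>n. diffs c n * x ^ n) * (\<alpha> * \<mu> powr (\<alpha> - 1))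
      = \<alpha> / \<mu> * (x * (\<Sum>n. diffs c n * x ^ n))"
    using assms by (simp add: x_def powr_diff)
  finally show ?thesis unfolding eq by (simp add: wseries_def[abs_def] c_def)
qed

lemma isCont_wseries:
  "\<alpha> > 0 \<Longrightarrow> poly_bounded g \<Longrightarrow> \<mu> > 0 \<Longrightarrow> isCont (wseries \<alpha> g) \<mu>"
  by (rule DERIV_isCont[OF has_real_derivative_wseries])

text \<open>The logarithm of a Poisson probability is a combination of \<open>n\<close>,
  \<open>ln n!\<close> and 1, and \<open>exp (- \<alpha> * \<mu>)\<close> cancels in the
  quotient.\<close>

lemma H_GR_eq:
  assumes "\<alpha> > 0" "\<mu> > 0"
  shows "H_GR \<alpha> \<mu> = \<mu> + (wseries \<alpha> (\<lambda>n. ln (fact n)) \<mu> - ln \<mu> * wseries \<alpha> real \<mu>)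
    / wseries \<alpha> (\<lambda>n. 1) \<mu>"
proof -
  define x where "x = \<mu> powr \<alpha>"
  note s = summable_poly_bounded_wt[OF assms(1), of _ x]
  have lnp: "ln (pmf (poisson_pmf \<mu>) n) = real n * ln \<mu> - ln (fact n) - \<mu>" for n
    using assms by (simp add: ln_div ln_mult ln_realpow)
  have den: "(\<Sum>n. pmf (poisson_pmf \<mu>) n powr \<alpha>) = exp (- \<alpha> * \<mu>) * wseries \<alpha> (\<lambda>n. 1) \<mu>"
    unfolding poisson_powr_eq[OF assms(2)] wseries_def
    using s[OF poly_bounded_const[of 1]] by (simp add: suminf_mult x_def)
  have "(\<lambda>n. exp (- \<alpha> * \<mu>) * (ln \<mu> * (real n * wt \<alpha> n * x ^ n) - ln (fact n) * wt \<alpha> n * x ^ n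
      - \<mu> * (1 * wt \<alpha> n * x ^ n)))
    sums (exp (- \<alpha> * \<mu>) * (ln \<mu> * wseries \<alpha> real \<mu> - wseries \<alpha> (\<lambda>n. ln (fact n)) \<mu>
      - \<mu> * wseries \<alpha> (\<lambda>n. 1) \<mu>))"
    unfolding wseries_def x_def[symmetric]
    by (intro sums_mult sums_diff summable_sums s poly_bounded_intros)
  then have "(\<Sum>n. pmf (poisson_pmf \<mu>) n powr \<alpha> * ln (pmf (poisson_pmf \<mu>) n))
    = exp (- \<alpha> * \<mu>) * (ln \<mu> * wseries \<alpha> real \<mu> - wseries \<alpha> (\<lambda>n. ln (fact n)) \<mu>
      - \<mu> * wseries \<alpha> (\<lambda>n. 1) \<mu>)"
    unfolding poisson_powr_eq[OF assms(2)] lnp x_def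
    by (simp add: sums_iff algebra_simps)
  then show ?thesis
    unfolding H_GR_def gen_renyi_entropy_def den
    using wseries_const_pos[OF assms] by (simp add: field_simps)
qed

lemma has_real_derivative_H_GR:
  fixes \<alpha> :: real
  defines "Q \<equiv> wseries \<alpha>" and "f \<equiv> \<lambda>n. ln (fact n)"
  assumes "\<alpha> > 0" "\<mu> > 0"
  shows "(H_GR \<alpha> has_real_derivative
    1 + ((\<alpha> / \<mu> * Q (\<lambda>n. real n * f n) \<mu>
          - (1 / \<mu> * Q real \<mu> + ln \<mu> * (\<alpha> / \<mu> * Q (\<lambda>n. real n * real n) \<mu>))) * Q (\<lambda>n. 1) \<mu>
        - (Q f \<mu> - ln \<mu> * Q real \<mu>) * (\<alpha> / \<mu> * Q real \<mu>)) / (Q (\<lambda>n. 1) \<mu>)\<^sup>2) (at \<mu>)"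
proof -
  have d: "(Q g has_real_derivative \<alpha> / \<mu> * Q (\<lambda>n. real n * g n) \<mu>) (at \<mu>)"
    if "poly_bounded g" for g
    unfolding Q_def using assms that by (intro has_real_derivative_wseries)
  have "((\<lambda>\<mu>. \<mu> + (Q f \<mu> - ln \<mu> * Q real \<mu>) / Q (\<lambda>n. 1) \<mu>) has_real_derivative
    1 + ((\<alpha> / \<mu> * Q (\<lambda>n. real n * f n) \<mu>
          - (1 / \<mu> * Q real \<mu> + ln \<mu> * (\<alpha> / \<mu> * Q (\<lambda>n. real n * real n) \<mu>))) * Q (\<lambda>n. 1) \<mu>
        - (Q f \<mu> - ln \<mu> * Q real \<mu>) * (\<alpha> / \<mu> * Q real \<mu>)) / (Q (\<lambda>n. 1) \<mu>)\<^sup>2) (at \<mu>)"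
    using wseries_const_pos[OF assms(3,4)] assms(4) unfolding Q_def[symmetric]
    by (auto intro!: derivative_eq_intros d poly_bounded_intros
          simp: f_def power2_eq_square)
  \<comment> \<open>The closed form is available for positive parameters only, so the derivative is
    transferred through equality near \<open>\<mu>\<close>.\<close>
  moreover have "\<forall>\<^sub>F x in nhds \<mu>. x + (Q f x - ln x * Q real x) / Q (\<lambda>n. 1) x = H_GR \<alpha> x"
    using eventually_nhds_in_open[of "{0<..}" \<mu>] assms(4)
    by (auto elim!: eventually_mono simp: H_GR_eq[OF assms(3)] Q_def f_def)
  ultimately show ?thesis
    by (subst DERIV_cong_ev[OF refl _ refl, symmetric])
qed

section \<open>Monotonicity near parameter 1\<close>

text \<open>The derivative at 1 is at most \<open>14 - \<alpha> * V / Z\<close> with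
  \<open>V \<ge> Z ^ 3 / 128\<close>, hence negative once
  \<open>\<alpha> * Z\<^sup>2 > 14 * 128 = 1792\<close>. Continuity of the derivative extends the
  sign to a neighborhood.\<close>

lemma H_GR_decreasing_near_1:
  assumes "0 < \<alpha>" "\<alpha> < 1"
  defines "Z \<equiv> wsum \<alpha> (\<lambda>n. 1)"
  assumes "Z \<ge> 4" "\<alpha> * Z\<^sup>2 > 1792"
  shows "\<exists>\<epsilon>>0. \<epsilon> \<le> 1 \<and> strict_antimono_on {1 - \<epsilon><..<1 + \<epsilon>} (H_GR \<alpha>)"
proof -
  define Q where "Q = wseries \<alpha>"
  define f where "f = (\<lambda>n. ln (fact n :: real))"
  define H' where "H' = (\<lambda>\<mu>. 1 + ((\<alpha> / \<mu> * Q (\<lambda>n. real n * f n) \<mu>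
          - (1 / \<mu> * Q real \<mu> + ln \<mu> * (\<alpha> / \<mu> * Q (\<lambda>n. real n * real n) \<mu>))) * Q (\<lambda>n. 1) \<mu>
        - (Q f \<mu> - ln \<mu> * Q real \<mu>) * (\<alpha> / \<mu> * Q real \<mu>)) / (Q (\<lambda>n. 1) \<mu>)\<^sup>2)"
  have deriv: "(H_GR \<alpha> has_real_derivative H' \<mu>) (at \<mu>)" if "\<mu> > 0" for \<mu>
    using has_real_derivative_H_GR[OF assms(1) that] by (simp add: H'_def Q_def f_def)
  have "isCont H' 1"
    unfolding H'_def Q_def f_def using wseries_const_pos[OF assms(1), of 1]
    by (intro continuous_intros isCont_wseries poly_bounded_intros assms) auto
  define M where "M = wsum \<alpha> real"
  define m where "m = M / Z"
  define V where "V = wsum \<alpha> (\<lambda>n. (real n - m)\<^sup>2)"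
  have Z: "Z > 0" using assms by simp
  have m0: "m \<ge> 0"
    unfolding m_def M_def using Z assms(1)
    by (intro divide_nonneg_pos wsum_nonneg poly_bounded_intros) auto
  have "wsum \<alpha> (\<lambda>n. f n * (real n - m)) = wsum \<alpha> (\<lambda>n. real n * f n - m * f n)"
    by (simp add: algebra_simps)
  also have "\<dots> = wsum \<alpha> (\<lambda>n. real n * f n) - m * wsum \<alpha> f"
    using wsum_diff[OF assms(1), of "\<lambda>n. real n * f n" "\<lambda>n. m * f n"]
      wsum_cmult[OF assms(1), of f m] by (simp add: f_def poly_bounded_intros)
  finally have cov: "wsum \<alpha> (\<lambda>n. f n * (real n - m)) = wsum \<alpha> (\<lambda>n. real n * f n) - m * wsum \<alpha> f" .
  \<comment> \<open>At parameter 1 the terms with \<open>ln \<mu>\<close> vanish, and the rest of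
    the quotient rule collapses to a covariance.\<close>
  have "H' 1 = (Z - M + \<alpha> * wsum \<alpha> (\<lambda>n. f n * (real n - m))) / Z"
    unfolding cov unfolding H'_def Q_def wseries_1 m_def using Z
    by (simp add: Z_def[symmetric] M_def[symmetric] field_simps power2_eq_square)
  also have "\<dots> \<le> (14 * Z - \<alpha> * V) / Z"
    using covariance_upper_bound[OF assms(1,2)] Z
    by (intro divide_right_mono) (auto simp: Z_def M_def m_def V_def f_def)
  also have "\<dots> < 0"
  proof -
    have "1792 * Z < \<alpha> * Z\<^sup>2 * Z" using assms(5) Z by (intro mult_strict_right_mono)
    also have "\<dots> = 128 * (\<alpha> * (Z ^ 3 / 128))" by (simp add: power2_eq_square power3_eq_cube)
    also have "\<dots> \<le> 128 * (\<alpha> * V)"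
      using variance_lower_bound[OF assms(1) m0] assms(1,4)
      by (intro mult_left_mono) (auto simp: V_def Z_def)
    finally show ?thesis using Z by (simp add: divide_less_0_iff mult.commute)
  qed
  finally have "H' 1 < 0" .
  then have "\<forall>\<^sub>F \<mu> in nhds 1. H' \<mu> < 0"
    using \<open>isCont H' 1\<close> by (intro order_tendstoD) (auto simp: isCont_def tendsto_nhds_iff)
  then obtain e where e: "e > 0" "\<And>\<mu>. dist \<mu> 1 < e \<Longrightarrow> H' \<mu> < 0"
    unfolding eventually_nhds_metric by blast
  \<comment> \<open>The cap at 1 keeps the interval inside the positive parameters, where the
    derivative formula is valid.\<close>
  define \<epsilon> where "\<epsilon> = min e 1"
  have "H_GR \<alpha> y < H_GR \<alpha> x" if "x \<in> {1 - \<epsilon><..<1 + \<epsilon>}" "y \<in> {1 - \<epsilon><..<1 + \<epsilon>}" "x < y" for x y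
  proof (rule DERIV_neg_imp_decreasing[OF \<open>x < y\<close>])
    fix z assume "x \<le> z" "z \<le> y"
    then have "dist z 1 < e" "z > 0" using that by (auto simp: \<epsilon>_def dist_real_def)
    then show "\<exists>d. (H_GR \<alpha> has_real_derivative d) (at z) \<and> d < 0"
      using deriv e(2) by blast
  qed
  then show ?thesis
    using e(1) by (intro exI[of _ \<epsilon>]) (auto simp: \<epsilon>_def monotone_on_def)
qed

theorem proposition5p4:
  shows "\<exists>J :: real set. is_interval J \<and> J \<subseteq> {0<..<1} \<and> (\<exists>\<delta>>0. {0<..<\<delta>} \<subseteq> J) \<and>
    (\<forall>\<alpha>\<in>J. \<exists>\<epsilon>>0. \<epsilon> \<le> 1 \<and> strict_antimono_on {1 - \<epsilon><..<1 + \<epsilon>} (H_GR \<alpha>))"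
proof -
  \<comment> \<open>The left side equals \<open>\<alpha> powr (- 1 / 3) * exp (- 4)\<close> and so
    tends to infinity at 0.\<close>
  have "\<forall>\<^sub>F \<alpha> in at_right (0::real). \<alpha> * (\<alpha> powr (- 2 / 3) * exp (- 2))\<^sup>2 > 1792"
    by real_asymp
  moreover have "\<forall>\<^sub>F \<alpha> in at_right (0::real). \<alpha> powr (- 2 / 3) * exp (- 2) \<ge> 4"
    by real_asymp
  moreover have "\<forall>\<^sub>F \<alpha> in at_right (0::real). \<alpha> < 1"
    by real_asymp
  ultimately have "\<forall>\<^sub>F \<alpha> in at_right (0::real). \<alpha> * (\<alpha> powr (- 2 / 3) * exp (- 2))\<^sup>2 > 1792 \<and>
      \<alpha> powr (- 2 / 3) * exp (- 2) \<ge> 4 \<and> \<alpha> < 1"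
    by eventually_elim auto
  then obtain \<delta> :: real where \<delta>: "\<delta> > 0"
    and small: "\<And>\<alpha>. 0 < \<alpha> \<Longrightarrow> \<alpha> < \<delta> \<Longrightarrow> \<alpha> * (\<alpha> powr (- 2 / 3) * exp (- 2))\<^sup>2 > 1792 \<and>
      \<alpha> powr (- 2 / 3) * exp (- 2) \<ge> 4 \<and> \<alpha> < 1"
    unfolding eventually_at_right_field by blast
  have "\<exists>\<epsilon>>0. \<epsilon> \<le> 1 \<and> strict_antimono_on {1 - \<epsilon><..<1 + \<epsilon>} (H_GR \<alpha>)"
    if "\<alpha> \<in> {0<..<\<delta>}" for \<alpha>
  proof (rule H_GR_decreasing_near_1)
    let ?z = "\<alpha> powr (- 2 / 3) * exp (- 2)"
    have \<alpha>: "0 < \<alpha>" "\<alpha> < \<delta>" using that by auto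
    note s = small[OF \<alpha>]
    note Z = total_weight_lower_bound[OF \<alpha>(1)]
    show "0 < \<alpha>" "\<alpha> < 1" "4 \<le> wsum \<alpha> (\<lambda>n. 1)" using \<alpha> s Z by linarith+
    have "\<alpha> * ?z\<^sup>2 \<le> \<alpha> * (wsum \<alpha> (\<lambda>n. 1))\<^sup>2"
      using \<alpha> Z by (intro mult_left_mono power_mono) auto
    then show "1792 < \<alpha> * (wsum \<alpha> (\<lambda>n. 1))\<^sup>2" using s by linarith
  qed
  moreover have "{0<..<\<delta>} \<subseteq> {0<..<1}" using small by auto
  ultimately show ?thesis
    using \<delta> by (intro exI[of _ "{0<..<\<delta>}"]) (auto simp: is_interval_oo)
qed

end
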